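(* Let $1\le m\le n/2$, let $a_1,\dots,a_m\in\mathbb R$, and let $Z$ be the $n\times n$ cyclic shift matrix (entries $Z_{i,j}=1$ if $i\equiv j+1 \pmod n$ and $0$ otherwise). Let $A=\sum_{i=1}^m a_i(Z^i+Z^{-i})$ and assume $I_n-A$ is invertible. Then the unitary DFT, the orthogonal RDFT, and the orthogonal DHT of size $n$ are KLTs for the homogeneous $m$th-order GMRF $(I_n-A)\mathbf s=\boldsymbol\nu$, i.e. for $$s_k=a_1(s_{k-1}+s_{k+1})+\dots+a_m(s_{k-m}+s_{k+m})+\nu_k,\quad 0\le k<n,$$ with periodic boundary conditions (indices modulo $n$).
   Context: Transforms, $0\le k,\ell<n$ ($k$ row, $\ell$ column), $j=\sqrt{-1}$: unitary DFT: $\frac1{\sqrt n}e^{-2\pi jk\ell/n}$. Orthogonal DHT: $\frac1{\sqrt n}\bigl(\cos\frac{2\pi k\ell}n+\sin\frac{2\pi k\ell}n\bigr)$. Orthogonal RDFT: $\sqrt{2/n}\,e_k r_{k,\ell}$ with $r_{k,\ell}=\cos\frac{2\pi k\ell}n$ for $0\le k\le n/2$, $r_{k,\ell}=-\sin\frac{2\pi k\ell}n$ for $n/2<k<n$, where $e_k=1/\sqrt2$ if $k=0$ or $k=n/2$ and $e_k=1$ otherwise. GMRF: for symmetric $A\in\mathbb R^{n\times n}$ with $I_n-A$ invertible, a zero-mean Gaussian vector $\mathbf s$ with $(I_n-A)\mathbf s=\boldsymbol\nu$ and covariance $\Sigma_{\mathbf s}=\sigma^2(I_n-A)^{-1}$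 if $I_n-A$ is positive definite (noise covariance $\sigma^2(I_n-A)$), and $\Sigma_{\mathbf s}=\sigma^2(I_n-A)^{-2}$ if $I_n-A$ has negative eigenvalues (noise covariance $\sigma^2I_n$). A KLT for the GMRF is a unitary matrix $F$ such that $F\Sigma_{\mathbf s}F^{-1}$ is diagonal. *)

theory Defs
  imports
    "HOL-Probability.Probability"
    "Jordan_Normal_Form.Schur_Decomposition"
    "Jordan_Normal_Form.Gauss_Jordan_Elimination"
begin

definition matinv :: "'a::field mat \<Rightarrow> 'a mat" where
  "matinv A = the (mat_inverse A)"

definition unitary_mat :: "nat \<Rightarrow> complex mat \<Rightarrow> bool" where
  "unitary_mat n U \<longleftrightarrow> U \<in> carrier_mat n n \<and>
     U * mat_adjoint U = 1\<^sub>m n \<and> mat_adjoint U * U = 1\<^sub>m n"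

definition positive_definite :: "nat \<Rightarrow> real mat \<Rightarrow> bool" where
  "positive_definite n B \<longleftrightarrow> B \<in> carrier_mat n n \<and> transpose_mat B = B \<and>
     (\<forall>v \<in> carrier_vec n. v \<noteq> 0\<^sub>v n \<longrightarrow> scalar_prod v (B *\<^sub>v v) > 0)"

definition dft_mat :: "nat \<Rightarrow> complex mat" where
  "dft_mat n = mat n n (\<lambda>(k, l).
     1 / complex_of_real (sqrt (real n)) *
       exp (- (2 * complex_of_real pi * \<i> * of_nat k * of_nat l / of_nat n)))"

definition dht_mat :: "nat \<Rightarrow> real mat" where
  "dht_mat n = mat n n (\<lambda>(k, l).
     1 / sqrt (real n) *
       (cos (2 * pi * real k * real l / real n) + sin (2 * pi * real k * real l / real n)))"

definition rdft_scale :: "nat \<Rightarrow> nat \<Rightarrow> real" where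
  "rdft_scale n k = (if k = 0 \<or> real k = real n / 2 then 1 / sqrt 2 else 1)"

definition rdft_entry :: "nat \<Rightarrow> nat \<Rightarrow> nat \<Rightarrow> real" where
  "rdft_entry n k l =
     (if real k \<le> real n / 2 then cos (2 * pi * real k * real l / real n)
      else - sin (2 * pi * real k * real l / real n))"

definition rdft_mat :: "nat \<Rightarrow> real mat" where
  "rdft_mat n = mat n n (\<lambda>(k, l). sqrt (2 / real n) * rdft_scale n k * rdft_entry n k l)"

definition cyclic_shift :: "nat \<Rightarrow> real mat" where
  "cyclic_shift n = mat n n (\<lambda>(i, j). if i mod n = (j + 1) mod n then 1 else 0)"

text \<open>The sum of the matrices \<open>a\<^sub>i (Z\<^sup>i + Z\<^sup>-\<^sup>i)\<close> is taken entrywise, as matrices of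
  dimension \<open>n\<close> are not a type of class \<open>comm_monoid_add\<close>.\<close>

definition homogeneous_mat :: "nat \<Rightarrow> nat \<Rightarrow> (nat \<Rightarrow> real) \<Rightarrow> real mat" where
  "homogeneous_mat n m a = mat n n (\<lambda>(r, c). \<Sum>i = 1..m.
     (a i \<cdot>\<^sub>m (cyclic_shift n ^\<^sub>m i + matinv (cyclic_shift n) ^\<^sub>m i)) $$ (r, c))"

definition cyclic_index :: "nat \<Rightarrow> int \<Rightarrow> nat" where
  "cyclic_index n k = nat (k mod int n)"

text \<open>A random vector of size \<open>n\<close> is given by its components \<open>s 0, \<dots>, s (n - 1)\<close>; the values
  \<open>s i\<close> for \<open>i \<ge> n\<close> are irrelevant. A vector is Gaussian if all linear combinations of its
  components are; a constant counts as a (degenerate) Gaussian variable.\<close>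

definition gaussian_rv :: "'w measure \<Rightarrow> ('w \<Rightarrow> real) \<Rightarrow> bool" where
  "gaussian_rv M X \<longleftrightarrow> X \<in> borel_measurable M \<and>
     ((\<exists>\<mu> \<tau>. \<tau> > 0 \<and> distributed M lborel X (\<lambda>x. ennreal (normal_density \<mu> \<tau> x))) \<or>
      (\<exists>\<mu>. AE \<omega> in M. X \<omega> = \<mu>))"

definition gaussian_vector :: "'w measure \<Rightarrow> nat \<Rightarrow> (nat \<Rightarrow> 'w \<Rightarrow> real) \<Rightarrow> bool" where
  "gaussian_vector M n s \<longleftrightarrow> (\<forall>i<n. s i \<in> borel_measurable M) \<and>
     (\<forall>c :: nat \<Rightarrow> real. gaussian_rv M (\<lambda>\<omega>. \<Sum>i<n. c i * s i \<omega>))"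

definition zero_mean :: "'w measure \<Rightarrow> nat \<Rightarrow> (nat \<Rightarrow> 'w \<Rightarrow> real) \<Rightarrow> bool" where
  "zero_mean M n s \<longleftrightarrow> (\<forall>i<n. integrable M (s i) \<and> (\<integral>\<omega>. s i \<omega> \<partial>M) = 0)"

definition covariance_mat :: "'w measure \<Rightarrow> nat \<Rightarrow> (nat \<Rightarrow> 'w \<Rightarrow> real) \<Rightarrow> real mat" where
  "covariance_mat M n s = mat n n (\<lambda>(i, j).
     \<integral>\<omega>. (s i \<omega> - (\<integral>\<xi>. s i \<xi> \<partial>M)) * (s j \<omega> - (\<integral>\<xi>. s j \<xi> \<partial>M)) \<partial>M)"

definition gmrf_matrix :: "nat \<Rightarrow> real mat \<Rightarrow> bool" where
  "gmrf_matrix n A \<longleftrightarrow> A \<in> carrier_mat n n \<and> transpose_mat A = A \<and> invertible_mat (1\<^sub>m n - A)"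

text \<open>\<open>gmrf M n A \<sigma> s \<nu>\<close>: on the probability space \<open>M\<close>, \<open>s\<close> is a Gaussian Markov random field
  with matrix \<open>A\<close> and noise \<open>\<nu>\<close>. Since \<open>1 - A\<close> is symmetric and invertible, exactly one of the
  two cases for the covariances applies.\<close>

definition gmrf ::
  "'w measure \<Rightarrow> nat \<Rightarrow> real mat \<Rightarrow> real \<Rightarrow> (nat \<Rightarrow> 'w \<Rightarrow> real) \<Rightarrow> (nat \<Rightarrow> 'w \<Rightarrow> real) \<Rightarrow> bool" where
  "gmrf M n A \<sigma> s \<nu> \<longleftrightarrow>
     gmrf_matrix n A \<and> gaussian_vector M n s \<and> zero_mean M n s \<and>
     (\<forall>i<n. \<nu> i \<in> borel_measurable M) \<and>
     (AE \<omega> in M. (1\<^sub>m n - A) *\<^sub>v vec n (\<lambda>i. s i \<omega>) = vec n (\<lambda>i. \<nu> i \<omega>)) \<and>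
     (positive_definite n (1\<^sub>m n - A) \<longrightarrow>
        covariance_mat M n s = \<sigma>\<^sup>2 \<cdot>\<^sub>m matinv (1\<^sub>m n - A) \<and>
        covariance_mat M n \<nu> = \<sigma>\<^sup>2 \<cdot>\<^sub>m (1\<^sub>m n - A)) \<and>
     ((\<exists>e<0. eigenvalue (1\<^sub>m n - A) e) \<longrightarrow>
        covariance_mat M n s = \<sigma>\<^sup>2 \<cdot>\<^sub>m (matinv (1\<^sub>m n - A) ^\<^sub>m 2) \<and>
        covariance_mat M n \<nu> = \<sigma>\<^sup>2 \<cdot>\<^sub>m 1\<^sub>m n)"

definition klt :: "'w measure \<Rightarrow> nat \<Rightarrow> (nat \<Rightarrow> 'w \<Rightarrow> real) \<Rightarrow> complex mat \<Rightarrow> bool" where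
  "klt M n s F \<longleftrightarrow> unitary_mat n F \<and>
     diagonal_mat (F * map_mat complex_of_real (covariance_mat M n s) * matinv F)"

end

theory Submission
  imports Defs
begin

text \<open>
  A symmetric stencil acts on the samples \<open>cos (2\<pi>kl/n)\<close> and \<open>sin (2\<pi>kl/n)\<close> by the same factor:
  \<open>f (l - i) + f (l + i) = 2 cos (2\<pi>ki/n) f l\<close> for both. Hence every combination of the two is an
  eigenvector of \<open>A\<close> with a real eigenvalue, and the \<open>k\<close>-th rows of the DFT, the DHT and the RDFT are
  all such combinations \<open>\<alpha> k cos + \<beta> k sin\<close>. Row orthogonality becomes one algebraic condition
  on the coefficients, since only the frequencies \<open>k = k'\<close> and \<open>k + k' \<equiv> 0 (mod n)\<close> interact.
  A unitary matrix that diagonalizes \<open>1 - A\<close> also diagonalizes its inverse and the square of the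
  inverse, that is, the covariance up to
  the factor \<open>\<sigma>\<^sup>2\<close>. The signs of the eigenvalues decide which of the two covariances applies; invertibility
  excludes the eigenvalue \<open>0\<close>.
\<close>

subsection \<open>Cyclic shifts\<close>

lemma int_cyclic_index: "0 < n \<Longrightarrow> int (cyclic_index n z) = z mod int n"
  by (simp add: cyclic_index_def)

lemma cyclic_index_less [simp]: "0 < n \<Longrightarrow> cyclic_index n z < n"
  by (simp add: cyclic_index_def nat_less_iff)

text \<open>Both equations say that \<open>n\<close> divides \<open>c + z - r\<close>. This trades a
  condition on the column for one on the row.\<close>

lemma cyclic_index_shift_iff:
  assumes "c < n" "r < n"
  shows "c = cyclic_index n (int r - z) \<longleftrightarrow> r = cyclic_index n (int c + z)"
proof -
  have n: "0 < n" using assms by simp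
  have "c = cyclic_index n (int r - z) \<longleftrightarrow> int c mod int n = (int r - z) mod int n"
    using assms n by (simp flip: of_nat_eq_iff[where 'a=int] add: int_cyclic_index)
  also have "\<dots> \<longleftrightarrow> int n dvd (int c + z) - int r"
    by (simp add: mod_eq_dvd_iff algebra_simps)
  also have "\<dots> \<longleftrightarrow> int r mod int n = (int c + z) mod int n"
    by (metis mod_eq_dvd_iff)
  also have "\<dots> \<longleftrightarrow> r = cyclic_index n (int c + z)"
    using assms n by (simp flip: of_nat_eq_iff[where 'a=int] add: int_cyclic_index)
  finally show ?thesis .
qed

lemma cyclic_index_add_cyclic_index:
  "0 < n \<Longrightarrow> cyclic_index n (int (cyclic_index n z) + w) = cyclic_index n (z + w)"
  by (simp flip: of_nat_eq_iff[where 'a=int] add: int_cyclic_index mod_simps)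

lemma cyclic_index_of_nat: "cyclic_index n (int c) = c mod n"
  by (simp add: cyclic_index_def flip: zmod_int)

text \<open>A matrix whose column \<open>c\<close> is the unit vector with index \<open>f c\<close>
  sends basis vectors to basis vectors, so multiplication is composition of the index
  functions.\<close>

lemma mult_mat_of_index_function:
  assumes "\<And>c. c < n \<Longrightarrow> f c < n" "\<And>c. c < n \<Longrightarrow> g c < n"
  shows "mat n n (\<lambda>(r, c). if r = f c then 1 else 0) * mat n n (\<lambda>(r, c). if r = g c then 1 else 0)
    = mat n n (\<lambda>(r, c). if r = f (g c) then 1 else (0::'a::semiring_1))"
  using assms
  by (intro eq_matI) (auto simp: scalar_prod_def if_distrib[of "\<lambda>x. _ * x"] cong: if_cong)

text \<open>All integer powers of the cyclic shift in one family, so that \<open>Z\<close> and its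
  inverse obey a single exponent law.\<close>

definition shift_mat :: "nat \<Rightarrow> int \<Rightarrow> real mat" where
  "shift_mat n z = mat n n (\<lambda>(r, c). if r = cyclic_index n (int c + z) then 1 else 0)"

lemma shift_mat_carrier [simp]: "shift_mat n z \<in> carrier_mat n n"
  by (simp add: shift_mat_def)

lemma shift_mat_0: "shift_mat n 0 = 1\<^sub>m n"
  by (intro eq_matI) (auto simp: shift_mat_def cyclic_index_of_nat)

lemma shift_mat_mult: "shift_mat n z * shift_mat n w = shift_mat n (z + w)"
proof (cases "n = 0")
  case True
  then show ?thesis by (intro eq_matI) (auto simp: shift_mat_def)
next
  case False
  then show ?thesis
    unfolding shift_mat_def
    by (subst mult_mat_of_index_function)
        (auto simp: cyclic_index_add_cyclic_index add.commute[of z] add.assoc)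
qed

lemma shift_mat_pow: "shift_mat n z ^\<^sub>m i = shift_mat n (int i * z)"
  by (induction i) (simp_all add: shift_mat_0 shift_mat_mult algebra_simps carrier_matD[OF shift_mat_carrier])

lemma cyclic_shift_eq: "cyclic_shift n = shift_mat n 1"
proof -
  have "cyclic_index n (int c + 1) = Suc c mod n" for c
    using cyclic_index_of_nat[of n "Suc c"] by (simp add: add.commute)
  then show ?thesis
    by (intro eq_matI) (auto simp: cyclic_shift_def shift_mat_def)
qed

text \<open>Over a field a right inverse of a square matrix is two-sided. Hence
  \<open>mat_inverse\<close> returns \<open>Some C\<close>, and associativity forces
  \<open>C = B\<close>.\<close>

lemma matinv_unique:
  assumes "A \<in> carrier_mat n n" "B \<in> carrier_mat n n" "A * B = 1\<^sub>m n"
  shows "matinv A = B"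
proof -
  have BA: "B * A = 1\<^sub>m n" using mat_mult_left_right_inverse[OF assms] .
  have "A \<in> Units (ring_mat TYPE('a) n ())"
    using assms BA by (auto simp: Units_def ring_mat_def)
  then obtain C where C: "mat_inverse A = Some C"
    using mat_inverse(1)[OF assms(1), of "()"] by (cases "mat_inverse A") auto
  then have "A * C = 1\<^sub>m n" "C \<in> carrier_mat n n"
    using mat_inverse(2)[OF assms(1) C] by auto
  then have "C = B"
    using BA assms assoc_mult_mat[OF assms(2,1), of C n] by simp
  with C show ?thesis by (simp add: matinv_def)
qed

lemma matinv_shift_mat: "matinv (shift_mat n z) = shift_mat n (- z)"
  by (rule matinv_unique[of _ n]) (simp_all add: shift_mat_mult shift_mat_0)

section \<open>The matrix \<open>A\<close> as a symmetric stencil\<close>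

lemma homogeneous_mat_carrier [simp]: "homogeneous_mat n m a \<in> carrier_mat n n"
  by (simp add: homogeneous_mat_def)

text \<open>The indicators are added, not joined by a disjunction: for \<open>2 * i = n\<close> the
  two neighbours coincide and \<open>a i\<close> counts twice. With \<open>c\<close> alone on the
  left, sums over columns collapse.\<close>

lemma homogeneous_mat_index:
  assumes "r < n" "c < n"
  shows "homogeneous_mat n m a $$ (r, c) = (\<Sum>i = 1..m. a i *
    ((if c = cyclic_index n (int r - int i) then 1 else 0) +
     (if c = cyclic_index n (int r + int i) then 1 else 0)))"
proof -
  \<comment> \<open>Both indicators are brought back to the form \<open>r = ...\<close> in which
    \<open>shift_mat\<close> is defined; the second equivalence is read from right to left.\<close>
  note [simp] = cyclic_index_shift_iff[OF assms(2,1)] cyclic_index_shift_iff[OF assms, symmetric]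
  show ?thesis
    using assms
    by (simp add: homogeneous_mat_def cyclic_shift_eq matinv_shift_mat shift_mat_pow)
      (simp add: shift_mat_def)
qed

lemma homogeneous_mat_symmetric:
  "transpose_mat (homogeneous_mat n m a) = homogeneous_mat n m a"
proof (intro eq_matI; simp add: carrier_matD[OF homogeneous_mat_carrier])
  fix r c assume rc: "r < n" "c < n"
  show "homogeneous_mat n m a $$ (c, r) = homogeneous_mat n m a $$ (r, c)"
    using rc by (simp add: homogeneous_mat_index cyclic_index_shift_iff add.commute)
qed

text \<open>Any real algebra is allowed, since the transforms need complex samples, while the
  eigenvectors and the difference equation need real ones.\<close>

lemma homogeneous_mat_apply:
  fixes x :: "nat \<Rightarrow> 'a::real_algebra_1"
  assumes "r < n"
  shows "(\<Sum>c<n. of_real (homogeneous_mat n m a $$ (r, c)) * x c) =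
    (\<Sum>i = 1..m. of_real (a i) * (x (cyclic_index n (int r - int i)) + x (cyclic_index n (int r + int i))))"
proof -
  have "(\<Sum>c<n. of_real (homogeneous_mat n m a $$ (r, c)) * x c) =
    (\<Sum>c<n. \<Sum>i = 1..m. of_real (a i) *
      ((if c = cyclic_index n (int r - int i) then x c else 0) +
       (if c = cyclic_index n (int r + int i) then x c else 0)))"
    using assms
    by (intro sum.cong refl) (auto simp: homogeneous_mat_index sum_distrib_right mult.assoc mult_2 intro!: sum.cong)
  also have "\<dots> = (\<Sum>i = 1..m. of_real (a i) * (\<Sum>c<n.
      (if c = cyclic_index n (int r - int i) then x c else 0) +
       (if c = cyclic_index n (int r + int i) then x c else 0)))"
    by (subst sum.swap) (simp only: sum_distrib_left)
  also have "\<dots> = (\<Sum>i = 1..m. of_real (a i) *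
      (x (cyclic_index n (int r - int i)) + x (cyclic_index n (int r + int i))))"
    using assms by (simp only: sum.distrib sum.delta finite_lessThan lessThan_iff cyclic_index_less if_True)
  finally show ?thesis .
qed

lemma precision_mat_carrier [simp]: "1\<^sub>m n - homogeneous_mat n m a \<in> carrier_mat n n"
  by (rule minus_carrier_mat) simp

lemma precision_mat_apply:
  fixes x :: "nat \<Rightarrow> 'a::real_algebra_1"
  assumes "r < n"
  shows "(\<Sum>c<n. of_real ((1\<^sub>m n - homogeneous_mat n m a) $$ (r, c)) * x c) = x r -
    (\<Sum>i = 1..m. of_real (a i) * (x (cyclic_index n (int r - int i)) + x (cyclic_index n (int r + int i))))"
proof -
  have "(\<Sum>c<n. of_real ((1\<^sub>m n - homogeneous_mat n m a) $$ (r, c)) * x c) =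
    (\<Sum>c<n. (if c = r then x c else 0) - of_real (homogeneous_mat n m a $$ (r, c)) * x c)"
    using assms
    by (intro sum.cong refl) (auto simp: algebra_simps carrier_matD[OF homogeneous_mat_carrier])
  then show ?thesis
    using assms by (simp only: sum_subtractf homogeneous_mat_apply[OF assms] sum.delta finite_lessThan
      lessThan_iff if_True)
qed

subsection \<open>Trigonometric rows\<close>

text \<open>Frequencies are integers because the orthogonality argument uses differences
  \<open>k - k'\<close>.\<close>

definition phase :: "nat \<Rightarrow> int \<Rightarrow> int \<Rightarrow> real" where
  "phase n k z = 2 * pi * real_of_int k * real_of_int z / real n"

lemma cis_phase_cyclic_index:
  assumes "0 < n"
  shows "cis (phase n k (int (cyclic_index n z))) = cis (phase n k z)"
proof -
  have "real_of_int z = real_of_int (z mod int n) + real n * real_of_int (z div int n)"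
    by (metis mod_mult_div_eq of_int_add of_int_mult of_int_of_nat_eq)
  then have "phase n k z = phase n k (int (cyclic_index n z)) + 2 * pi * real_of_int (k * (z div int n))"
    using assms by (simp add: phase_def int_cyclic_index field_simps)
  then have "cis (phase n k z) =
      cis (phase n k (int (cyclic_index n z))) * cis (2 * pi * real_of_int (k * (z div int n)))"
    by (simp only: cis_mult)
  then show ?thesis by (simp only: cis_multiple_2pi Ints_of_int mult_1_right)
qed

text \<open>A geometric sum whose ratio is an \<open>n\<close>-th root of unity; the ratio is 1
  exactly if \<open>n\<close> divides \<open>k\<close>.\<close>

lemma sum_cis_phase:
  assumes "0 < n"
  shows "(\<Sum>l<n. cis (phase n k (int l))) = (if int n dvd k then of_nat n else 0)"
proof -
  let ?w = "cis (phase n k 1)"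
  have "(\<Sum>l<n. cis (phase n k (int l))) = (\<Sum>l<n. ?w ^ l)"
    by (simp add: Complex.DeMoivre phase_def mult_ac)
  also have "\<dots> = (if int n dvd k then of_nat n else 0)"
  proof (cases "int n dvd k")
    case True
    then obtain q where "k = int n * q" by auto
    then have "phase n k 1 = 2 * pi * real_of_int q" using assms by (simp add: phase_def)
    then have "?w = 1" by simp
    with True show ?thesis by simp
  next
    case False
    have "?w \<noteq> 1"
    proof
      assume "?w = 1"
      then have "cos (phase n k 1) = 1" by (simp add: complex_eq_iff)
      then obtain q :: int where "phase n k 1 = q * 2 * pi" by (auto simp: cos_one_2pi_int)
      then have "real_of_int k = real_of_int (int n * q)" using assms by (simp add: phase_def field_simps)
      then show False using False by (metis dvd_triv_left of_int_eq_iff)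
    qed
    moreover have "?w ^ n = 1"
    proof -
      have "?w ^ n = cis (2 * pi * real_of_int k)"
        using assms by (simp add: Complex.DeMoivre phase_def)
      then show ?thesis by simp
    qed
    ultimately show ?thesis using False by (simp add: geometric_sum)
  qed
  finally show ?thesis .
qed

lemma sum_cos_phase:
  "0 < n \<Longrightarrow> (\<Sum>l<n. cos (phase n k (int l))) = (if int n dvd k then real n else 0)"
  using arg_cong[OF sum_cis_phase, of n Re k] by (simp split: if_splits)

lemma sum_sin_phase: "0 < n \<Longrightarrow> (\<Sum>l<n. sin (phase n k (int l))) = 0"
  using arg_cong[OF sum_cis_phase, of n Im k] by (simp split: if_splits)

lemma phase_add: "phase n k (z + w) = phase n k z + phase n k w"
  and phase_diff: "phase n k (z - w) = phase n k z - phase n k w"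
  by (simp_all add: phase_def algebra_simps add_divide_distrib diff_divide_distrib)

lemma cos_phase_cyclic_index:
  "0 < n \<Longrightarrow> cos (phase n k (int (cyclic_index n z))) = cos (phase n k z)"
  and sin_phase_cyclic_index:
  "0 < n \<Longrightarrow> sin (phase n k (int (cyclic_index n z))) = sin (phase n k z)"
  using cis_phase_cyclic_index[of n k z] by (simp_all add: complex_eq_iff)

text \<open>The symbol of the circulant matrix \<open>1 - A\<close> at frequency \<open>k\<close>;
  the symmetry of the stencil leaves only cosines.\<close>

definition precision_eigenvalue :: "nat \<Rightarrow> nat \<Rightarrow> (nat \<Rightarrow> real) \<Rightarrow> nat \<Rightarrow> real" where
  "precision_eigenvalue n m a k = 1 - (\<Sum>i = 1..m. a i * (2 * cos (phase n (int k) (int i))))"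

definition trig_row :: "nat \<Rightarrow> nat \<Rightarrow> 'a \<Rightarrow> 'a \<Rightarrow> nat \<Rightarrow> 'a::real_field" where
  "trig_row n k \<alpha> \<beta> l =
     \<alpha> * of_real (cos (phase n (int k) (int l))) + \<beta> * of_real (sin (phase n (int k) (int l)))"

lemma homogeneous_mat_trig_row:
  assumes "r < n"
  shows "(\<Sum>c<n. of_real (homogeneous_mat n m a $$ (r, c)) * trig_row n k \<alpha> \<beta> c) =
    of_real (1 - precision_eigenvalue n m a k) * trig_row n k \<alpha> \<beta> r"
proof -
  have n: "0 < n" using assms by simp
  have "trig_row n k \<alpha> \<beta> (cyclic_index n (int r - int i)) + trig_row n k \<alpha> \<beta> (cyclic_index n (int r + int i))
    = of_real (2 * cos (phase n (int k) (int i))) * trig_row n k \<alpha> \<beta> r" for i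
    by (simp add: trig_row_def cos_phase_cyclic_index[OF n] sin_phase_cyclic_index[OF n]
        phase_add phase_diff cos_add cos_diff sin_add sin_diff algebra_simps)
  then show ?thesis
    by (simp add: homogeneous_mat_apply[OF assms] precision_eigenvalue_def sum_distrib_right mult.assoc)
qed

lemma precision_mat_trig_row:
  assumes "r < n"
  shows "(\<Sum>c<n. of_real ((1\<^sub>m n - homogeneous_mat n m a) $$ (r, c)) * trig_row n k \<alpha> \<beta> c) =
    of_real (precision_eigenvalue n m a k) * trig_row n k \<alpha> \<beta> r"
  unfolding precision_mat_apply[OF assms] homogeneous_mat_apply[OF assms, symmetric]
    homogeneous_mat_trig_row[OF assms]
  by (simp add: left_diff_distrib)

definition trig_mat :: "nat \<Rightarrow> (nat \<Rightarrow> complex) \<Rightarrow> (nat \<Rightarrow> complex) \<Rightarrow> complex mat" where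
  "trig_mat n \<alpha> \<beta> = mat n n (\<lambda>(k, l). trig_row n k (\<alpha> k) (\<beta> k) l)"

lemma trig_mat_carrier [simp]: "trig_mat n \<alpha> \<beta> \<in> carrier_mat n n"
  by (simp add: trig_mat_def)

text \<open>The rows are needed as left eigenvectors, whereas \<open>precision_mat_trig_row\<close>
  gives right ones; the symmetry of \<open>A\<close> closes the gap. In this form no inverse of the
  transform occurs, and the coefficients are arbitrary.\<close>

lemma trig_mat_intertwines:
  "trig_mat n \<alpha> \<beta> * map_mat complex_of_real (1\<^sub>m n - homogeneous_mat n m a) =
   mat_diag n (\<lambda>k. complex_of_real (precision_eigenvalue n m a k)) * trig_mat n \<alpha> \<beta>"
proof -
  let ?B = "1\<^sub>m n - homogeneous_mat n m a"
  let ?R = "mat n n (\<lambda>(i, j). complex_of_real (precision_eigenvalue n m a i) * trig_mat n \<alpha> \<beta> $$ (i, j))"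
  have sym: "?B $$ (r, c) = ?B $$ (c, r)" if "r < n" "c < n" for r c
    using that arg_cong[OF homogeneous_mat_symmetric, of "\<lambda>X. X $$ (r, c)" n m a]
    by (auto simp: carrier_matD[OF homogeneous_mat_carrier])
  show ?thesis
    unfolding mat_diag_mult_left[OF trig_mat_carrier]
  proof (rule eq_matI)
    fix k c
    assume "k < dim_row ?R" and "c < dim_col ?R"
    then have kc: "k < n" "c < n" by simp_all
    have "(trig_mat n \<alpha> \<beta> * map_mat complex_of_real ?B) $$ (k, c) =
      (\<Sum>r<n. trig_row n k (\<alpha> k) (\<beta> k) r * of_real (?B $$ (r, c)))"
      using kc by (simp add: scalar_prod_def trig_mat_def atLeast0LessThan
        carrier_matD[OF homogeneous_mat_carrier])
    also have "\<dots> = (\<Sum>r<n. of_real (?B $$ (c, r)) * trig_row n k (\<alpha> k) (\<beta> k) r)"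
    proof (intro sum.cong refl)
      fix r assume "r \<in> {..<n}"
      then have "?B $$ (r, c) = ?B $$ (c, r)" using sym[of r c] kc by simp
      then show "trig_row n k (\<alpha> k) (\<beta> k) r * of_real (?B $$ (r, c)) =
        of_real (?B $$ (c, r)) * trig_row n k (\<alpha> k) (\<beta> k) r"
        by (simp only: mult.commute)
    qed
    also have "\<dots> = of_real (precision_eigenvalue n m a k) * trig_mat n \<alpha> \<beta> $$ (k, c)"
      using kc by (simp only: precision_mat_trig_row) (simp add: trig_mat_def)
    finally show "(trig_mat n \<alpha> \<beta> * map_mat complex_of_real ?B) $$ (k, c) =
      ?R $$ (k, c)"
      using kc by simp
  qed (simp_all add: carrier_matD[OF homogeneous_mat_carrier] carrier_matD[OF trig_mat_carrier])
qed

section \<open>Orthogonality of trigonometric rows\<close>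

text \<open>With \<open>c\<close>, \<open>s\<close> and \<open>c'\<close>, \<open>s'\<close> the
  cosines and sines of two angles, the second factors on the right are the cosine of the difference,
  the cosine of the sum, the sine of the sum and the sine of the difference.\<close>

lemma trig_product_to_sum:
  fixes a b c s :: "'a::comm_ring_1"
  shows "2 * ((a * c + b * s) * (a' * c' + b' * s')) =
     (a * a' + b * b') * (c * c' + s * s') + (a * a' - b * b') * (c * c' - s * s') +
     (a * b' + b * a') * (s * c' + c * s') + (b * a' - a * b') * (s * c' - c * s')"
  by (simp add: algebra_simps)

lemma mat_adjoint_index:
  "i < dim_col A \<Longrightarrow> j < dim_row A \<Longrightarrow> mat_adjoint A $$ (i, j) = conjugate (A $$ (j, i))"
  by (simp add: mat_adjoint_def mat_of_rows_index)

lemma mat_adjoint_carrier [simp]: "A \<in> carrier_mat n m \<Longrightarrow> mat_adjoint A \<in> carrier_mat m n"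
  by (metis mat_adjoint_def mat_of_rows_carrier(1) length_map cols_length carrier_matD)

text \<open>Over a full period all sines sum to 0, and a cosine survives only if its frequency,
  \<open>k - k'\<close> or \<open>k + k'\<close>, is a multiple of \<open>n\<close>. The factor 2
  avoids halves.\<close>

lemma sum_trig_row_cnj:
  assumes "0 < n"
  shows "2 * (\<Sum>l<n. trig_row n k \<alpha> \<beta> l * cnj (trig_row n k' \<alpha>' \<beta>' l)) = of_nat n *
    ((if int n dvd int k - int k' then \<alpha> * cnj \<alpha>' + \<beta> * cnj \<beta>' else 0) +
     (if int n dvd int k + int k' then \<alpha> * cnj \<alpha>' - \<beta> * cnj \<beta>' else 0))"
proof -
  let ?m = "\<lambda>l. phase n (int k - int k') (int l)" and ?p = "\<lambda>l. phase n (int k + int k') (int l)"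
  have "2 * (trig_row n k \<alpha> \<beta> l * cnj (trig_row n k' \<alpha>' \<beta>' l)) =
     (\<alpha> * cnj \<alpha>' + \<beta> * cnj \<beta>') * of_real (cos (?m l)) +
     (\<alpha> * cnj \<alpha>' - \<beta> * cnj \<beta>') * of_real (cos (?p l)) +
     (\<alpha> * cnj \<beta>' + \<beta> * cnj \<alpha>') * of_real (sin (?p l)) +
     (\<beta> * cnj \<alpha>' - \<alpha> * cnj \<beta>') * of_real (sin (?m l))" for l
  proof -
    have e: "?p l = phase n (int k) (int l) + phase n (int k') (int l)"
      "?m l = phase n (int k) (int l) - phase n (int k') (int l)"
      by (simp_all add: phase_def algebra_simps add_divide_distrib diff_divide_distrib)
    show ?thesis
      unfolding e trig_row_def cos_add cos_diff sin_add sin_diff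
        complex_cnj_add complex_cnj_mult complex_cnj_complex_of_real
        of_real_add of_real_diff of_real_mult
      by (rule trig_product_to_sum)
  qed
  then have "2 * (\<Sum>l<n. trig_row n k \<alpha> \<beta> l * cnj (trig_row n k' \<alpha>' \<beta>' l)) =
     (\<alpha> * cnj \<alpha>' + \<beta> * cnj \<beta>') * of_real (\<Sum>l<n. cos (?m l)) +
     (\<alpha> * cnj \<alpha>' - \<beta> * cnj \<beta>') * of_real (\<Sum>l<n. cos (?p l)) +
     (\<alpha> * cnj \<beta>' + \<beta> * cnj \<alpha>') * of_real (\<Sum>l<n. sin (?p l)) +
     (\<beta> * cnj \<alpha>' - \<alpha> * cnj \<beta>') * of_real (\<Sum>l<n. sin (?m l))"
    by (simp only: sum.distrib sum_distrib_left of_real_sum)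
  then show ?thesis
    unfolding sum_cos_phase[OF assms] sum_sin_phase[OF assms]
    by (cases "int n dvd int k - int k'"; cases "int n dvd int k + int k'") (simp_all add: algebra_simps)
qed

text \<open>The hypothesis is orthonormality of the rows, scaled by \<open>2 / n\<close>. For a
  square matrix this already gives the other product.\<close>

lemma trig_mat_unitary:
  assumes "0 < n"
    and "\<And>k k'. k < n \<Longrightarrow> k' < n \<Longrightarrow>
      (if k = k' then \<alpha> k * cnj (\<alpha> k') + \<beta> k * cnj (\<beta> k') else 0) +
      (if n dvd k + k' then \<alpha> k * cnj (\<alpha> k') - \<beta> k * cnj (\<beta> k') else 0) =
      (if k = k' then 2 / of_nat n else 0)"
  shows "unitary_mat n (trig_mat n \<alpha> \<beta>)"
proof -
  let ?F = "trig_mat n \<alpha> \<beta>"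
  have "?F * mat_adjoint ?F = 1\<^sub>m n"
  proof (rule eq_matI)
    fix k k' assume "k < dim_row (1\<^sub>m n :: complex mat)" "k' < dim_col (1\<^sub>m n :: complex mat)"
    then have kk: "k < n" "k' < n" by simp_all
    \<comment> \<open>For indices below \<open>n\<close> the difference is a multiple of
      \<open>n\<close> only if it is 0, whereas the sum can also be \<open>n\<close>.\<close>
    have dvd: "int n dvd int k - int k' \<longleftrightarrow> k = k'" "int n dvd int k + int k' \<longleftrightarrow> n dvd k + k'"
      using kk by (auto simp flip: mod_eq_dvd_iff of_nat_add)
    have "2 * (?F * mat_adjoint ?F) $$ (k, k') =
      2 * (\<Sum>l<n. trig_row n k (\<alpha> k) (\<beta> k) l * cnj (trig_row n k' (\<alpha> k') (\<beta> k') l))"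
      using kk by (simp add: scalar_prod_def atLeast0LessThan mat_adjoint_index
        carrier_matD[OF trig_mat_carrier] carrier_matD[OF mat_adjoint_carrier[OF trig_mat_carrier]])
        (simp add: trig_mat_def)
    also have "\<dots> = of_nat n * (if k = k' then 2 / of_nat n else 0)"
      unfolding sum_trig_row_cnj[OF assms(1)] dvd assms(2)[OF kk] ..
    also have "\<dots> = 2 * 1\<^sub>m n $$ (k, k')"
      using kk by simp
    finally show "(?F * mat_adjoint ?F) $$ (k, k') = 1\<^sub>m n $$ (k, k')" by simp
  qed (simp_all add: carrier_matD[OF trig_mat_carrier] carrier_matD[OF mat_adjoint_carrier[OF trig_mat_carrier]])
  then show ?thesis
    by (simp add: unitary_mat_def mat_mult_left_right_inverse[of _ n])
qed

subsection \<open>The three transforms\<close>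

lemma trig_mat_unitary_of_real:
  fixes \<alpha> \<beta> :: "nat \<Rightarrow> real"
  assumes "0 < n"
    and "\<And>k k'. k < n \<Longrightarrow> k' < n \<Longrightarrow>
      (if k = k' then \<alpha> k * \<alpha> k' + \<beta> k * \<beta> k' else 0) +
      (if n dvd k + k' then \<alpha> k * \<alpha> k' - \<beta> k * \<beta> k' else 0) =
      (if k = k' then 2 / real n else 0)"
  shows "unitary_mat n (trig_mat n (\<lambda>k. complex_of_real (\<alpha> k)) (\<lambda>k. complex_of_real (\<beta> k)))"
proof (rule trig_mat_unitary[OF assms(1)], goal_cases)
  case (1 k k')
  from assms(2)[OF 1, THEN arg_cong[where f = complex_of_real]] show ?case
    by (simp only: of_real_add of_real_diff of_real_mult of_real_0 if_distrib[where f = complex_of_real]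
        complex_cnj_complex_of_real of_real_divide of_real_numeral of_real_of_nat_eq)
qed

text \<open>The kernel is the conjugate of \<open>cis\<close>, hence the coefficient
  \<open>- \<i>\<close> of the sine.\<close>

lemma dft_mat_eq:
  "dft_mat n = trig_mat n (\<lambda>_. 1 / sqrt (real n)) (\<lambda>_. - \<i> / sqrt (real n))"
proof -
  have "exp (- (2 * complex_of_real pi * \<i> * of_nat k * of_nat l / of_nat n)) =
    cnj (cis (phase n (int k) (int l)))" for k l
    by (simp add: cis_cnj phase_def) (simp add: cis_conv_exp mult_ac)
  then show ?thesis
    by (intro eq_matI) (simp_all add: dft_mat_def trig_mat_def trig_row_def complex_eq_iff)
qed

lemma dht_mat_eq:
  "map_mat complex_of_real (dht_mat n) = trig_mat n (\<lambda>_. 1 / sqrt (real n)) (\<lambda>_. 1 / sqrt (real n))"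
  by (intro eq_matI)
    (simp_all add: dht_mat_def trig_mat_def trig_row_def phase_def algebra_simps add_divide_distrib)

text \<open>The scale appears only with the cosine because it is 1 on all sine rows, where
  \<open>2 * k > n\<close>.\<close>

lemma rdft_mat_eq:
  "map_mat complex_of_real (rdft_mat n) = trig_mat n
     (\<lambda>k. if 2 * k \<le> n then sqrt (2 / real n) * rdft_scale n k else 0)
     (\<lambda>k. if 2 * k \<le> n then 0 else - sqrt (2 / real n))"
proof -
  have "real k \<le> real n / 2 \<longleftrightarrow> 2 * k \<le> n" for k by linarith
  then show ?thesis
    by (intro eq_matI)
      (auto simp: rdft_mat_def rdft_entry_def rdft_scale_def trig_mat_def trig_row_def phase_def)
qed

text \<open>Both coefficients have modulus \<open>1 / sqrt n\<close> at every frequency, so the term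
  for \<open>n dvd k + k'\<close> cancels and the diagonal one is \<open>2 / n\<close>. The DHT
  below works for the same reason.\<close>

lemma unitary_dft_mat: "0 < n \<Longrightarrow> unitary_mat n (dft_mat n)"
  unfolding dft_mat_eq
  by (rule trig_mat_unitary) (auto simp: field_simps simp flip: of_real_mult)

lemma unitary_dht_mat:
  assumes "0 < n"
  shows "unitary_mat n (map_mat complex_of_real (dht_mat n))"
  unfolding dht_mat_eq
  by (rule trig_mat_unitary_of_real[OF assms]) simp

lemma add_dvd_below:
  fixes n k k' :: nat
  assumes "k < n" "k' < n" "n dvd k + k'"
  shows "k = 0 \<and> k' = 0 \<or> k + k' = n"
proof -
  obtain q where q: "k + k' = n * q" using assms(3) by auto
  have "n * q < n * 2" using assms q by linarith
  then have "q = 0 \<or> q = 1" by (auto simp: mult_less_cancel1)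
  then show ?thesis using q by auto
qed

lemma unitary_rdft_mat:
  assumes "0 < n"
  shows "unitary_mat n (map_mat complex_of_real (rdft_mat n))"
  unfolding rdft_mat_eq
proof (rule trig_mat_unitary_of_real[OF assms], goal_cases)
  case (1 k k')
  have scale: "rdft_scale n j = (if j = 0 \<or> 2 * j = n then 1 / sqrt 2 else 1)" for j
  proof -
    have "real j = real n / 2 \<longleftrightarrow> 2 * j = n" by linarith
    then show ?thesis by (simp add: rdft_scale_def)
  qed
  show ?case
  proof (cases "k = k'")
    case True
    \<comment> \<open>These are the frequencies that alias with themselves. There both terms
      contribute, and the scale \<open>1 / sqrt 2\<close> halves each of them.\<close>
    have "n dvd k + k \<longleftrightarrow> k = 0 \<or> 2 * k = n"
      using add_dvd_below[of k n k] 1 by (auto simp flip: mult_2)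
    then show ?thesis
      unfolding True[symmetric] scale
      by (cases "k = 0 \<or> 2 * k = n"; cases "2 * k \<le> n")
        (simp_all add: real_sqrt_divide)
  next
    case False
    \<comment> \<open>Distinct aliasing frequencies add up to \<open>n\<close> and so lie on
      opposite sides of \<open>n / 2\<close>: one row is a pure cosine, the other a pure sine, and
      both products vanish.\<close>
    then have "n dvd k + k' \<Longrightarrow> \<not> (2 * k \<le> n \<longleftrightarrow> 2 * k' \<le> n)"
      using add_dvd_below[of k n k'] 1 by auto
    with False show ?thesis by auto
  qed
qed

subsection \<open>Diagonalization of the covariance\<close>

text \<open>The case distinction in \<open>gmrf\<close> speaks of real eigenvalues, so the witness
  is the real cosine row. It is nonzero because its entry at 0 is \<open>cos 0 = 1\<close>.\<close>

lemma eigenvalue_precision_mat: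
  assumes "k < n"
  shows "eigenvalue (1\<^sub>m n - homogeneous_mat n m a) (precision_eigenvalue n m a k)"
proof -
  let ?v = "vec n (trig_row n k (1::real) 0)"
  have "?v $ 0 \<noteq> 0\<^sub>v n $ 0"
    using assms by (simp add: trig_row_def phase_def)
  then have "?v \<noteq> 0\<^sub>v n" by metis
  moreover have "(1\<^sub>m n - homogeneous_mat n m a) *\<^sub>v ?v = precision_eigenvalue n m a k \<cdot>\<^sub>v ?v"
  proof (rule eq_vecI)
    fix r assume "r < dim_vec (precision_eigenvalue n m a k \<cdot>\<^sub>v ?v)"
    then have r: "r < n" by simp
    have "((1\<^sub>m n - homogeneous_mat n m a) *\<^sub>v ?v) $ r =
      (\<Sum>c<n. (1\<^sub>m n - homogeneous_mat n m a) $$ (r, c) * trig_row n k 1 0 c)"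
      using r by (simp add: scalar_prod_def atLeast0LessThan carrier_matD[OF homogeneous_mat_carrier])
    also have "\<dots> = (precision_eigenvalue n m a k \<cdot>\<^sub>v ?v) $ r"
      using precision_mat_trig_row[OF r, of m a k "1::real" 0] r by simp
    finally show "((1\<^sub>m n - homogeneous_mat n m a) *\<^sub>v ?v) $ r = (precision_eigenvalue n m a k \<cdot>\<^sub>v ?v) $ r" .
  qed (simp add: carrier_matD[OF homogeneous_mat_carrier])
  ultimately show ?thesis
    by (auto simp: eigenvalue_def eigenvector_def carrier_matD[OF homogeneous_mat_carrier] intro!: exI[of _ ?v])
qed

section \<open>Positive definiteness from a diagonalization\<close>

lemma scalar_prod_mult_mat_vec:
  fixes B :: "'a::comm_semiring_0 mat"
  assumes "B \<in> carrier_mat n n" "v \<in> carrier_vec n"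
  shows "scalar_prod v (B *\<^sub>v v) = (\<Sum>i<n. \<Sum>j<n. v $ i * (B $$ (i, j) * v $ j))"
  using assms by (simp add: scalar_prod_def atLeast0LessThan sum_distrib_left)

text \<open>With \<open>w = F v\<close>, the quadratic form is the sum of
  \<open>d k * |w k|^2\<close>. As \<open>F\<close> is injective, some \<open>w k\<close> is
  nonzero.\<close>

lemma positive_definite_if_diagonalized:
  assumes B: "B \<in> carrier_mat n n" "transpose_mat B = B"
    and F: "unitary_mat n F"
    and d: "F * map_mat complex_of_real B = mat_diag n (\<lambda>k. complex_of_real (d k)) * F"
    and pos: "\<And>k. k < n \<Longrightarrow> d k > 0"
  shows "positive_definite n B"
  unfolding positive_definite_def
proof (intro conjI B ballI impI)
  fix v :: "real vec" assume v: "v \<in> carrier_vec n" "v \<noteq> 0\<^sub>v n"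
  have FF: "F \<in> carrier_mat n n" "mat_adjoint F \<in> carrier_mat n n" "mat_adjoint F * F = 1\<^sub>m n"
    using F by (auto simp: unitary_mat_def)
  define w where "w k = (\<Sum>i<n. F $$ (k, i) * of_real (v $ i))" for k
  have "map_mat complex_of_real B = mat_adjoint F * (F * map_mat complex_of_real B)"
    using FF B by (simp flip: assoc_mult_mat[of _ n n _ n _ n])
  then have Beq: "map_mat complex_of_real B = mat_adjoint F * (mat_diag n (\<lambda>k. complex_of_real (d k)) * F)"
    by (simp only: d)
  have Bij: "of_real (B $$ (i, j)) = (\<Sum>k<n. cnj (F $$ (k, i)) * (of_real (d k) * F $$ (k, j)))"
    if "i < n" "j < n" for i j
  proof -
    have "of_real (B $$ (i, j)) = map_mat complex_of_real B $$ (i, j)"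
      using that B by simp
    then show ?thesis
      using that FF unfolding Beq mat_diag_mult_left[OF FF(1)]
      by (simp add: scalar_prod_def atLeast0LessThan mat_adjoint_index)
  qed
  have cw: "cnj (w k) = (\<Sum>i<n. cnj (F $$ (k, i)) * of_real (v $ i))" for k
    by (simp add: w_def)
  have "complex_of_real (scalar_prod v (B *\<^sub>v v)) = (\<Sum>i<n. \<Sum>j<n. \<Sum>k<n.
      of_real (v $ i) * (cnj (F $$ (k, i)) * (of_real (d k) * F $$ (k, j)) * of_real (v $ j)))"
    using v B by (simp add: scalar_prod_mult_mat_vec Bij sum_distrib_left sum_distrib_right mult.assoc)
  also have "\<dots> = (\<Sum>k<n. \<Sum>i<n. \<Sum>j<n.
      of_real (v $ i) * (cnj (F $$ (k, i)) * (of_real (d k) * F $$ (k, j)) * of_real (v $ j)))"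
    by (rule trans[OF sum.cong[OF refl sum.swap] sum.swap])
  also have "\<dots> = (\<Sum>k<n. of_real (d k) * (cnj (w k) * w k))"
    unfolding cw unfolding w_def sum_product unfolding sum_distrib_left
    by (intro sum.cong refl) (simp add: mult_ac)
  also have "\<dots> = of_real (\<Sum>k<n. d k * (cmod (w k))\<^sup>2)"
    by (simp only: of_real_sum of_real_mult complex_norm_square mult.commute)
  finally have q: "scalar_prod v (B *\<^sub>v v) = (\<Sum>k<n. d k * (cmod (w k))\<^sup>2)"
    by (simp only: of_real_eq_iff)
  have "\<exists>k<n. w k \<noteq> 0"
  proof (rule ccontr)
    assume "\<not> (\<exists>k<n. w k \<noteq> 0)"
    then have "F *\<^sub>v map_vec of_real v = 0\<^sub>v n"
      using FF v by (intro eq_vecI) (auto simp: scalar_prod_def atLeast0LessThan w_def)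
    then have "mat_adjoint F *\<^sub>v (F *\<^sub>v map_vec of_real v) = 0\<^sub>v n"
      using FF by (intro eq_vecI) (simp_all add: scalar_prod_def carrier_matD[OF FF(2)])
    then have "map_vec complex_of_real v = 0\<^sub>v n"
      using FF v by (simp flip: assoc_mult_mat_vec[of _ n n _ n])
    then have "complex_of_real (v $ i) = 0" if "i < n" for i
      using that v by (metis carrier_vecD index_map_vec(1) index_zero_vec(1))
    then show False using v by (auto intro: eq_vecI)
  qed
  then obtain k where k: "k < n" "w k \<noteq> 0" by auto
  have "0 < (\<Sum>k<n. d k * (cmod (w k))\<^sup>2)"
    using k pos by (intro sum_pos2[of _ k]) (auto simp: less_imp_le)
  with q show "scalar_prod v (B *\<^sub>v v) > 0" by simp
qed

text \<open>The inverse of a unitary \<open>F\<close> is its adjoint, so the relation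
  \<open>d\<close> turns the conjugated covariance into \<open>mat_diag n d\<close>.\<close>

lemma klt_if_diagonalized:
  assumes F: "unitary_mat n F" and C: "covariance_mat M n s = C"
    and d: "F * map_mat complex_of_real C = mat_diag n d * F"
  shows "klt M n s F"
proof -
  have FF: "F \<in> carrier_mat n n" "mat_adjoint F \<in> carrier_mat n n" "F * mat_adjoint F = 1\<^sub>m n"
    using F by (auto simp: unitary_mat_def)
  have "F * map_mat complex_of_real C * matinv F = mat_diag n d * (F * mat_adjoint F)"
    using FF by (simp add: d matinv_unique[OF FF] assoc_mult_mat[of _ n n _ n _ n])
  also have "\<dots> = mat_diag n d"
    by (simp add: FF(3) right_mult_one_mat[OF mat_diag_dim])
  finally have "diagonal_mat (F * map_mat complex_of_real C * matinv F)"
    by (simp add: diagonal_mat_def mat_diag_def)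
  with F C show ?thesis by (simp add: klt_def)
qed

section \<open>Diagonalization of products, multiples and inverses\<close>

lemma intertwines_mult:
  fixes F :: "'a::comm_ring_1 mat"
  assumes "F \<in> carrier_mat n n" "C \<in> carrier_mat n n" "D \<in> carrier_mat n n"
    and "F * C = mat_diag n d * F" "F * D = mat_diag n e * F"
  shows "F * (C * D) = mat_diag n (\<lambda>k. d k * e k) * F"
proof -
  have "F * (C * D) = mat_diag n d * F * D"
    using assoc_mult_mat[OF assms(1-3)] assms(4) by simp
  also have "\<dots> = mat_diag n d * (mat_diag n e * F)"
    using assoc_mult_mat[OF mat_diag_dim assms(1,3)] assms(5) by simp
  also have "\<dots> = mat_diag n d * mat_diag n e * F"
    using assoc_mult_mat[OF mat_diag_dim mat_diag_dim assms(1)] by simp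
  finally show ?thesis by simp
qed

lemma intertwines_smult:
  fixes F :: "'a::comm_ring_1 mat"
  assumes "F \<in> carrier_mat n n" "C \<in> carrier_mat n n" "F * C = mat_diag n d * F"
  shows "F * (c \<cdot>\<^sub>m C) = mat_diag n (\<lambda>k. c * d k) * F"
proof -
  have "F * (c \<cdot>\<^sub>m C) = c \<cdot>\<^sub>m (mat_diag n d * F)"
    using assms by (simp add: mult_smult_distrib)
  then show ?thesis
    using assms(1) by (simp add: mat_diag_mult_left[of _ n n]) (auto intro!: eq_matI)
qed

text \<open>Multiplying the relation for \<open>C\<close> by \<open>D\<close> from the right gives
  \<open>F = mat_diag n d * (F * D)\<close>. If \<open>d k\<close> were 0, row \<open>k\<close> of
  \<open>F\<close> would vanish, contrary to \<open>F * G = 1\<close>; so one can divide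
  entrywise.\<close>

lemma intertwines_inverse:
  fixes F :: "'a::field mat"
  assumes F: "F \<in> carrier_mat n n" "G \<in> carrier_mat n n" "F * G = 1\<^sub>m n"
    and C: "C \<in> carrier_mat n n" "D \<in> carrier_mat n n" "C * D = 1\<^sub>m n"
    and d: "F * C = mat_diag n d * F"
  shows "k < n \<Longrightarrow> d k \<noteq> 0" and "F * D = mat_diag n (\<lambda>k. inverse (d k)) * F"
proof -
  have "F = mat_diag n d * (F * D)"
    using F C by (simp add: d flip: assoc_mult_mat[of _ n n _ n _ n])
      (simp flip: d add: assoc_mult_mat[of _ n n _ n _ n])
  then have e: "F $$ (k, l) = d k * (F * D) $$ (k, l)" if "k < n" "l < n" for k l
    using that F C by (subst (asm) mat_diag_mult_left[of _ n n]) (auto dest: arg_cong[of _ _ "\<lambda>X. X $$ (k, l)"])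
  have nz: "d k \<noteq> 0" if k: "k < n" for k
  proof
    assume "d k = 0"
    then have "F $$ (k, l) = 0" if "l < n" for l using e[OF k that] by simp
    moreover have "(F * G) $$ (k, k) = (\<Sum>l<n. F $$ (k, l) * G $$ (l, k))"
      using F(1,2) k by (simp add: scalar_prod_def atLeast0LessThan)
    ultimately show False using F(3) k by simp
  qed
  then show "k < n \<Longrightarrow> d k \<noteq> 0" .
  show "F * D = mat_diag n (\<lambda>k. inverse (d k)) * F"
    unfolding mat_diag_mult_left[OF F(1)]
    using F C nz e by (intro eq_matI) (auto simp del: index_mult_mat(1))
qed

text \<open>\<open>invertible_mat\<close> leaves the dimensions of the inverse open; they follow by
  comparing those of the two products.\<close>

lemma invertible_matE:
  fixes B :: "'a::semiring_1 mat"
  assumes "invertible_mat B" "B \<in> carrier_mat n n"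
  obtains C where "C \<in> carrier_mat n n" "B * C = 1\<^sub>m n"
proof -
  obtain C where C: "B * C = 1\<^sub>m n" "C * B = 1\<^sub>m (dim_row C)"
    using assms by (auto simp: invertible_mat_def inverts_mat_def)
  have "dim_col C = n" using arg_cong[OF C(1), of dim_col] by simp
  moreover have "dim_row C = n" using arg_cong[OF C(2), of dim_col] assms(2) by simp
  ultimately show thesis using C(1) that by blast
qed

lemma klt_trig_mat:
  assumes n: "0 < n"
    and F: "unitary_mat n (trig_mat n \<alpha> \<beta>)"
    and inv: "invertible_mat (1\<^sub>m n - homogeneous_mat n m a)"
    and gmrf: "gmrf M n (homogeneous_mat n m a) \<sigma> s \<nu>"
  shows "klt M n s (trig_mat n \<alpha> \<beta>)"
proof -
  let ?B = "1\<^sub>m n - homogeneous_mat n m a" and ?F = "trig_mat n \<alpha> \<beta>"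
  obtain C where C: "C \<in> carrier_mat n n" "?B * C = 1\<^sub>m n"
    using invertible_matE[OF inv precision_mat_carrier] .
  have matinv: "matinv ?B = C"
    using matinv_unique[OF precision_mat_carrier C] .
  have FF: "mat_adjoint ?F \<in> carrier_mat n n" "?F * mat_adjoint ?F = 1\<^sub>m n"
    using F by (auto simp: unitary_mat_def)
  have BC: "map_mat complex_of_real ?B * map_mat complex_of_real C = 1\<^sub>m n"
    unfolding of_real_hom.mat_hom_mult[OF precision_mat_carrier C(1), symmetric] C(2)
    by (rule of_real_hom.mat_hom_one)
  have carriers: "map_mat complex_of_real ?B \<in> carrier_mat n n" "map_mat complex_of_real C \<in> carrier_mat n n"
    using C by simp_all
  have smult: "map_mat complex_of_real (c \<cdot>\<^sub>m X) = complex_of_real c \<cdot>\<^sub>m map_mat complex_of_real X" for c X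
    by (intro eq_matI) simp_all
  note inverse = intertwines_inverse[OF trig_mat_carrier FF carriers BC trig_mat_intertwines]
  have "klt M n s ?F" if "positive_definite n ?B"
  proof (rule klt_if_diagonalized[OF F])
    show "covariance_mat M n s = \<sigma>\<^sup>2 \<cdot>\<^sub>m C"
      using gmrf that by (simp add: gmrf_def matinv)
    show "?F * map_mat complex_of_real (\<sigma>\<^sup>2 \<cdot>\<^sub>m C) = mat_diag n
        (\<lambda>k. complex_of_real (\<sigma>\<^sup>2) * inverse (complex_of_real (precision_eigenvalue n m a k))) * ?F"
      unfolding smult
      by (rule intertwines_smult[OF trig_mat_carrier carriers(2) inverse(2)])
  qed
  moreover have "klt M n s ?F" if "\<exists>e<0. eigenvalue ?B e"
  proof (rule klt_if_diagonalized[OF F])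
    show "covariance_mat M n s = \<sigma>\<^sup>2 \<cdot>\<^sub>m (C * C)"
      using gmrf that C by (simp add: gmrf_def matinv numeral_2_eq_2)
    show "?F * map_mat complex_of_real (\<sigma>\<^sup>2 \<cdot>\<^sub>m (C * C)) = mat_diag n (\<lambda>k. complex_of_real (\<sigma>\<^sup>2) *
        (inverse (complex_of_real (precision_eigenvalue n m a k)) *
         inverse (complex_of_real (precision_eigenvalue n m a k)))) * ?F"
      unfolding smult of_real_hom.mat_hom_mult[OF C(1) C(1)]
      by (rule intertwines_smult[OF trig_mat_carrier mult_carrier_mat[OF carriers(2) carriers(2)]
          intertwines_mult[OF trig_mat_carrier carriers(2) carriers(2) inverse(2) inverse(2)]])
  qed
  \<comment> \<open>\<open>gmrf\<close> fixes the covariance only under one of these two conditions.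
    A symbol value that is not positive is negative, since invertibility excludes 0.\<close>
  moreover have "positive_definite n ?B \<or> (\<exists>e<0. eigenvalue ?B e)"
  proof (cases "\<forall>k<n. precision_eigenvalue n m a k > 0")
    case True
    have "transpose_mat ?B = ?B"
      using homogeneous_mat_symmetric[of n m a] by (simp add: transpose_minus[of _ n n])
    with True show ?thesis
      using positive_definite_if_diagonalized[OF precision_mat_carrier _ F trig_mat_intertwines] by blast
  next
    case False
    then obtain k where "k < n" "\<not> precision_eigenvalue n m a k > 0" by blast
    then have "precision_eigenvalue n m a k < 0" using inverse(1)[of k] by simp
    then show ?thesis using eigenvalue_precision_mat[OF \<open>k < n\<close>] by blast
  qed
  ultimately show ?thesis by blast
qed

text \<open>Reading the matrix equation row by row and moving the neighbours to the other side gives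
  the recursion with periodic boundary conditions.\<close>

lemma precision_mat_equation_iff:
  fixes x v :: "nat \<Rightarrow> real"
  shows "(1\<^sub>m n - homogeneous_mat n m a) *\<^sub>v vec n x = vec n v \<longleftrightarrow>
    (\<forall>k<n. x k = (\<Sum>i = 1..m. a i * (x (cyclic_index n (int k - int i)) +
                                   x (cyclic_index n (int k + int i)))) + v k)"
proof -
  have "((1\<^sub>m n - homogeneous_mat n m a) *\<^sub>v vec n x) $ k = x k - (\<Sum>i = 1..m. a i *
    (x (cyclic_index n (int k - int i)) + x (cyclic_index n (int k + int i))))" if k: "k < n" for k
    using k precision_mat_apply[OF k, of m a x]
    by (simp add: scalar_prod_def atLeast0LessThan carrier_matD[OF homogeneous_mat_carrier])
  then show ?thesis
    by (simp add: vec_eq_iff carrier_matD[OF homogeneous_mat_carrier] diff_eq_eq add.commute)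
qed

theorem theorem34:
  fixes n m :: nat and a :: "nat \<Rightarrow> real" and \<sigma> :: real and M :: "'w measure"
  assumes "1 \<le> m" and "real m \<le> real n / 2"
    and "invertible_mat (1\<^sub>m n - homogeneous_mat n m a)"
    and "prob_space M"
  shows "gmrf_matrix n (homogeneous_mat n m a) \<and>
    (\<forall>x v :: nat \<Rightarrow> real.
      (1\<^sub>m n - homogeneous_mat n m a) *\<^sub>v vec n x = vec n v \<longleftrightarrow>
      (\<forall>k<n. x k = (\<Sum>i = 1..m. a i * (x (cyclic_index n (int k - int i)) +
                                     x (cyclic_index n (int k + int i)))) + v k)) \<and>
    (\<forall>s \<nu>. gmrf M n (homogeneous_mat n m a) \<sigma> s \<nu> \<longrightarrow>
      klt M n s (dft_mat n) \<and>
      klt M n s (map_mat complex_of_real (rdft_mat n)) \<and>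
      klt M n s (map_mat complex_of_real (dht_mat n)))"
proof -
  let ?A = "homogeneous_mat n m a"
  \<comment> \<open>The bounds on \<open>m\<close> force \<open>n\<close> to be at least 2.\<close>
  have n: "0 < n" using assms(1,2) by linarith
  have "gmrf_matrix n ?A"
    using assms(3) by (simp add: gmrf_matrix_def homogeneous_mat_symmetric)
  moreover have "klt M n s (dft_mat n) \<and> klt M n s (map_mat complex_of_real (rdft_mat n)) \<and>
      klt M n s (map_mat complex_of_real (dht_mat n))" if "gmrf M n ?A \<sigma> s \<nu>" for s \<nu>
    using unitary_dft_mat[OF n] unitary_rdft_mat[OF n] unitary_dht_mat[OF n]
      klt_trig_mat[OF n _ assms(3) that]
    unfolding dft_mat_eq rdft_mat_eq dht_mat_eq by blast
  ultimately show ?thesis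
    using precision_mat_equation_iff by blast
qed

end
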